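(* For any odd prime number $p$ and any positive integer $k$, $\mathrm{Inv}(\mathbb{Z}_{p^k}[x])=\{1,-1\}$.
   Context: $\mathbb{Z}_m$ denotes the ring of integers modulo $m$. For a commutative ring $R$ with identity, an element $u\in R$ is an involution if $u^2=1$, and $\mathrm{Inv}(R)$ denotes the set of involutions of $R$. *)

theory Defs
  imports "HOL-Algebra.UnivPoly" "HOL-Number_Theory.Residues"
begin

definition involutions :: "('a, 'b) ring_scheme \<Rightarrow> 'a set"
  where "involutions R = {u \<in> carrier R. u [^]\<^bsub>R\<^esub> (2::nat) = \<one>\<^bsub>R\<^esub>}"

end

theory Submission
  imports Defs "HOL-Computational_Algebra.Polynomial"
begin

text \<open>
  A polynomial \<open>u\<close> over the residue ring modulo \<open>p ^ k\<close> lifts to an integer polynomial \<open>f\<close>, and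
  \<open>u\<close> is an involution iff \<open>p ^ k\<close> divides \<open>f\<^sup>2 - 1 = (f - 1) * (f + 1)\<close> in \<open>\<int>[x]\<close>.
  There the constant \<open>p\<close> is a prime element, by Gauss's lemma. It cannot divide both factors, because
  their difference is \<open>2\<close> and \<open>p\<close> is odd. So one factor is not divisible by \<open>p\<close> at all, and all \<open>k\<close>
  copies of \<open>p\<close> go into the other one; that is, \<open>f\<close> is congruent to \<open>1\<close> or \<open>-1\<close> modulo \<open>p ^ k\<close>.

  The number-theoretic part is \<open>prime_elem_power_dvd_square_minus_one\<close>. The transfer to the
  residue ring uses that coefficientwise reduction \<open>reduce_poly\<close> is a surjective ring homomorphism
  with kernel the multiples of the modulus.
\<close>

text \<open>
  The hypothesis \<open>\<not> p dvd 2\<close> makes \<open>a - 1\<close> and \<open>a + 1\<close> share no factor \<open>p\<close>, so the power of \<open>p\<close>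
  cannot be split between them.
\<close>

lemma prime_elem_power_dvd_square_minus_one:
  fixes p a :: "'a :: {idom, algebraic_semidom}"
  assumes "prime_elem p" and "\<not> p dvd 2" and "p ^ k dvd a\<^sup>2 - 1"
  shows "p ^ k dvd a - 1 \<or> p ^ k dvd a + 1"
proof -
  have prod: "p ^ k dvd (a - 1) * (a + 1)"
    using assms(3) by (simp add: power2_eq_square algebra_simps)
  have "\<not> (p dvd a - 1 \<and> p dvd a + 1)"
  proof
    assume "p dvd a - 1 \<and> p dvd a + 1"
    then have "p dvd (a + 1) - (a - 1)"
      by (blast intro: dvd_diff)
    then show False
      using assms(2) by (simp add: algebra_simps)
  qed
  \<comment> \<open>With exponents summing to \<open>k + 1\<close>: the factor that escapes \<open>p\<close> forces \<open>p ^ k\<close> into the other.\<close>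
  then show ?thesis
    using prime_elem_power_dvd_cases[OF prod, of k 1] prime_elem_power_dvd_cases[OF prod, of 1 k]
      \<open>prime_elem p\<close> by auto
qed

definition reduce_poly :: "int \<Rightarrow> int poly \<Rightarrow> nat \<Rightarrow> int"
  where "reduce_poly m f = (\<lambda>n. poly.coeff f n mod m)"

lemma reduce_poly_eq_iff: "reduce_poly m f = reduce_poly m g \<longleftrightarrow> [:m:] dvd f - g"
  by (simp add: reduce_poly_def fun_eq_iff const_poly_dvd_iff mod_eq_dvd_iff)

context residues
begin

sublocale up: UP_cring R "UP R"
  by unfold_locales

lemma reduce_poly_closed: "reduce_poly m f \<in> carrier (UP R)"
proof -
  have "bound \<zero> (degree f) (reduce_poly m f)"
    by (auto simp: bound_def reduce_poly_def res_zero_eq coeff_eq_0)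
  then have "reduce_poly m f \<in> up R"
    by (intro mem_upI) (auto simp: reduce_poly_def)
  then show ?thesis
    by (simp add: UP_def)
qed

lemma coeff_reduce_poly: "up_ring.coeff (UP R) (reduce_poly m f) n = poly.coeff f n mod m"
  using reduce_poly_closed[of f] by (simp add: UP_def) (simp add: reduce_poly_def)

lemma reduce_poly_one: "reduce_poly m 1 = \<one>\<^bsub>UP R\<^esub>"
  by (rule up.up_eqI)
    (simp_all add: reduce_poly_closed coeff_reduce_poly one_cong zero_cong)

lemma reduce_poly_uminus: "reduce_poly m (- f) = \<ominus>\<^bsub>UP R\<^esub> reduce_poly m f"
  by (rule up.up_eqI) (simp_all add: reduce_poly_closed coeff_reduce_poly neg_cong)

lemma reduce_poly_mult: "reduce_poly m (f * g) = reduce_poly m f \<otimes>\<^bsub>UP R\<^esub> reduce_poly m g"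
  by (rule up.up_eqI)
    (simp_all add: reduce_poly_closed coeff_reduce_poly mult_cong sum_cong Polynomial.coeff_mult)

text \<open>
  The residues are themselves integers in \<open>{0..m - 1}\<close>, so the coefficient sequence of \<open>u\<close>, read in
  \<open>\<int>\<close>, is already a lift.
\<close>

lemma reduce_poly_surj:
  assumes "u \<in> carrier (UP R)"
  obtains f where "u = reduce_poly m f"
proof
  have u: "u \<in> up R"
    using assms by (simp add: UP_def)
  then obtain N where "bound \<zero> N u"
    by blast
  then have "\<forall>i>N. u i = 0"
    by (auto simp: bound_def res_zero_eq)
  then have "poly.coeff (Abs_poly u) = u"
    by (intro ext coeff_Abs_poly) auto
  moreover have "u n mod m = u n" for n
    using mem_upD[OF u, of n] by (simp add: res_carrier_eq)
  ultimately show "u = reduce_poly m (Abs_poly u)"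
    by (simp add: reduce_poly_def)
qed

end

theorem proposition2p3:
  fixes p k :: nat
  assumes "prime p" and "odd p" and "k > 0"
  shows "involutions (UP (residue_ring (int (p ^ k)))) =
    {\<one>\<^bsub>UP (residue_ring (int (p ^ k)))\<^esub>,
     \<ominus>\<^bsub>UP (residue_ring (int (p ^ k)))\<^esub> \<one>\<^bsub>UP (residue_ring (int (p ^ k)))\<^esub>}"
proof -
  define m where "m = int (p ^ k)"
  define R where "R = residue_ring m"
  have "p > 1"
    using \<open>prime p\<close> by (rule prime_gt_1_nat)
  then have "m > 1"
    using \<open>k > 0\<close> by (simp add: m_def one_less_power)
  then interpret residues m R
    by unfold_locales (simp_all add: R_def)
  have prime: "prime_elem [:int p:]"
    using \<open>prime p\<close> by (intro lift_prime_elem_poly) (simp flip: prime_nat_int_transfer)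
  have m_power: "[:m:] = [:int p:] ^ k"
    by (simp add: m_def poly_const_pow)
  have not_dvd_2: "\<not> [:int p:] dvd 2"
  proof
    assume "[:int p:] dvd 2"
    then have "int p dvd 2"
      by (metis const_poly_dvd_const_poly_iff numeral_poly)
    then have "p dvd 2"
      by presburger
    then show False
      using \<open>prime p\<close> \<open>odd p\<close> by (metis primes_dvd_imp_eq two_is_prime_nat dvd_refl)
  qed
  have square: "reduce_poly m f [^]\<^bsub>UP R\<^esub> (2::nat) = \<one>\<^bsub>UP R\<^esub> \<longleftrightarrow> [:m:] dvd f\<^sup>2 - 1" for f
  proof -
    have "reduce_poly m f [^]\<^bsub>UP R\<^esub> (2::nat) = reduce_poly m (f\<^sup>2)"
      by (simp add: numeral_2_eq_2 reduce_poly_mult reduce_poly_closed)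
    then show ?thesis
      by (simp add: reduce_poly_eq_iff flip: reduce_poly_one)
  qed
  have "u \<in> involutions (UP R) \<longleftrightarrow> u = \<one>\<^bsub>UP R\<^esub> \<or> u = \<ominus>\<^bsub>UP R\<^esub> \<one>\<^bsub>UP R\<^esub>" (is "?L \<longleftrightarrow> ?R") for u
  proof
    assume ?L
    then have "u \<in> carrier (UP R)" and u2: "u [^]\<^bsub>UP R\<^esub> (2::nat) = \<one>\<^bsub>UP R\<^esub>"
      by (auto simp: involutions_def)
    then obtain f where u: "u = reduce_poly m f"
      by (elim reduce_poly_surj)
    have "[:int p:] ^ k dvd f\<^sup>2 - 1"
      using u2 by (simp add: u square flip: m_power)
    then have "[:m:] dvd f - 1 \<or> [:m:] dvd f - (- 1)"
      using prime_elem_power_dvd_square_minus_one[OF prime not_dvd_2] by (simp add: m_power)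
    then show ?R
      by (simp only: u flip: reduce_poly_eq_iff reduce_poly_one reduce_poly_uminus)
  next
    assume ?R
    then obtain f :: "int poly" where "u = reduce_poly m f" and "f = 1 \<or> f = - 1"
      by (metis reduce_poly_one reduce_poly_uminus)
    then show ?L
      using square[of f] by (auto simp: involutions_def reduce_poly_closed)
  qed
  then show ?thesis
    unfolding R_def m_def by blast
qed

end
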